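(* Let $K\ge 1$ and let $f\in\mathcal{S}_H$ be a $K$-quasiconformal harmonic mapping from $\mathbb{D}$ onto a bounded Pommerenke interior domain $G$ (with respect to $f$). If there are constants $M>0$ and $\delta\in(0,1)$ such that for each $\zeta\in\partial\mathbb{D}$ and for $0\leq r\leq\rho<1$, $$\|D_f(\rho\zeta)\|\leq M\,\|D_f(r\zeta)\|\left(\frac{1-\rho}{1-r}\right)^{\delta-1},$$ then $\|D_f\|\in H^1_g(\mathbb{D})$.
   Context: $\mathbb{D}$ is the open unit disk in $\mathbb{C}$ and $\mathbb{D}_r=\{z:|z|<r\}$. A harmonic mapping in $\mathbb{D}$ is a complex-valued function whose real and imaginary parts are real harmonic; it can be written $f=h+\overline{g}$ with $h,g$ analytic, unique with $g(0)=0$. $\mathcal{S}_H$ is the family of sense-preserving univalent harmonic mappings $f=h+\overline{g}$ in $\mathbb{D}$ with $h(0)=g(0)=0$, $h'(0)=1$. $\|D_f\|=|f_z|+|f_{\overline z}|$, $l(D_f)=\big||f_z|-|f_{\overline z}|\big|$, where $f_z=\frac12(f_x-if_y)$, $f_{\overline z}=\frac12(f_x+if_y)$; $\det D_f=|f_z|^2-|f_{\overline z}|^2$. For $K\ge1$, a sense-preserving homeomorphism $f$ of a domain $\Omega_0$ onto a domain $\Omega_0'$, in the Sobolev class $W^{1,2}_{loc}(\Omega_0)$, is $K$-quasiconformal if $\|D_f(z)\|^2\le K\det D_f(z)$, i.e. $\|D_f(z)\|\le K\,l(D_f(z))$, for $z\in\Omega_0$. Pommerenke interior domain: let $f\in\mathcal{S}_H$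 be a $K$-quasiconformal harmonic mapping of $\mathbb{D}$ onto $G$. For $0<r<1$ and distinct $w_1,w_2\in f(\partial\mathbb{D}_r)$, let $\gamma_r[w_1,w_2]$ be the smaller (i.e. shorter) subarc of $f(\partial\mathbb{D}_r)$ between $w_1$ and $w_2$, let $\ell(\gamma_r[w_1,w_2])$ be its length, and let $d_{G_r}(w_1,w_2)=\inf_\Gamma\operatorname{diam}\Gamma$, where $\Gamma$ runs through all arcs from $w_1$ to $w_2$ that lie in $G_r=f(\mathbb{D}_r)$ except for their endpoints. $G$ is called a Pommerenke interior domain if $$\sup_{0<r<1}\ \sup_{w_1\ne w_2\in f(\partial\mathbb{D}_r)}\frac{\ell(\gamma_r[w_1,w_2])}{d_{G_r}(w_1,w_2)}<\infty .$$ Generalized Hardy space: $H^1_g(\mathbb{D})$ consists of all measurable $F:\mathbb{D}\to\mathbb{C}$ such that $M_1(r,F)=\frac1{2\pi}\int_0^{2\pi}|F(re^{i\theta})|\,d\theta$ exists for all $r\in(0,1)$ and $\sup_{0<r<1}M_1(r,F)<\infty$. *)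

theory Defs
  imports "HOL-Complex_Analysis.Complex_Analysis"
begin

section \<open>Partial derivatives and harmonic mappings\<close>

definition pdx :: "(complex \<Rightarrow> 'a::real_normed_vector) \<Rightarrow> complex \<Rightarrow> 'a" where
  "pdx f z = vector_derivative (\<lambda>x. f (Complex x (Im z))) (at (Re z))"

definition pdy :: "(complex \<Rightarrow> 'a::real_normed_vector) \<Rightarrow> complex \<Rightarrow> 'a" where
  "pdy f z = vector_derivative (\<lambda>y. f (Complex (Re z) y)) (at (Im z))"

definition C1_on :: "complex set \<Rightarrow> (complex \<Rightarrow> 'a::real_normed_vector) \<Rightarrow> bool" where
  "C1_on U f \<longleftrightarrow>
     (\<forall>z\<in>U. f differentiable (at z)) \<and> continuous_on U (pdx f) \<and> continuous_on U (pdy f)"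

definition real_harmonic_on :: "complex set \<Rightarrow> (complex \<Rightarrow> real) \<Rightarrow> bool" where
  "real_harmonic_on U u \<longleftrightarrow>
     C1_on U u \<and> C1_on U (pdx u) \<and> C1_on U (pdy u) \<and>
     (\<forall>z\<in>U. pdx (pdx u) z + pdy (pdy u) z = 0)"

definition harmonic_mapping_on :: "complex set \<Rightarrow> (complex \<Rightarrow> complex) \<Rightarrow> bool" where
  "harmonic_mapping_on U f \<longleftrightarrow>
     real_harmonic_on U (\<lambda>z. Re (f z)) \<and> real_harmonic_on U (\<lambda>z. Im (f z))"

definition D_z :: "(complex \<Rightarrow> complex) \<Rightarrow> complex \<Rightarrow> complex" where
  "D_z f z = (pdx f z - \<i> * pdy f z) / 2"

definition D_zbar :: "(complex \<Rightarrow> complex) \<Rightarrow> complex \<Rightarrow> complex" where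
  "D_zbar f z = (pdx f z + \<i> * pdy f z) / 2"

definition D_norm :: "(complex \<Rightarrow> complex) \<Rightarrow> complex \<Rightarrow> real" where
  "D_norm f z = norm (D_z f z) + norm (D_zbar f z)"

definition D_det :: "(complex \<Rightarrow> complex) \<Rightarrow> complex \<Rightarrow> real" where
  "D_det f z = (norm (D_z f z))\<^sup>2 - (norm (D_zbar f z))\<^sup>2"

section \<open>Sense-preserving maps and the class \<open>S\<^sub>H\<close>\<close>

text \<open>
  For an injective continuous map of an open set, sense-preserving means local degree \<open>+1\<close>:
  the image of a small positively oriented circle about \<open>z\<close> winds once around \<open>f z\<close>.
  For univalent harmonic mappings this is equivalent to a positive Jacobian (Lewy).
\<close>

definition sense_preserving_on :: "complex set \<Rightarrow> (complex \<Rightarrow> complex) \<Rightarrow> bool" where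
  "sense_preserving_on U f \<longleftrightarrow>
     (\<forall>z r. 0 < r \<and> cball z r \<subseteq> U \<longrightarrow> winding_number (f \<circ> circlepath z r) (f z) = 1)"

definition S_H :: "(complex \<Rightarrow> complex) set" where
  "S_H = {f. harmonic_mapping_on (ball 0 1) f \<and> inj_on f (ball 0 1) \<and>
             sense_preserving_on (ball 0 1) f \<and>
             (\<exists>h g. h holomorphic_on ball 0 1 \<and> g holomorphic_on ball 0 1 \<and>
                    (\<forall>z\<in>ball 0 1. f z = h z + cnj (g z)) \<and>
                    h 0 = 0 \<and> g 0 = 0 \<and> deriv h 0 = 1)}"

section \<open>Quasiconformal mappings\<close>

definition L2_loc :: "complex set \<Rightarrow> (complex \<Rightarrow> complex) \<Rightarrow> bool" where
  "L2_loc U f \<longleftrightarrow> f \<in> borel_measurable (lebesgue_on U) \<and>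
     (\<forall>S. compact S \<and> S \<subseteq> U \<longrightarrow> set_integrable lebesgue S (\<lambda>z. (norm (f z))\<^sup>2))"

definition test_function :: "complex set \<Rightarrow> (complex \<Rightarrow> real) \<Rightarrow> bool" where
  "test_function U \<phi> \<longleftrightarrow> C1_on UNIV \<phi> \<and> (\<exists>S. compact S \<and> S \<subseteq> U \<and> (\<forall>z. z \<notin> S \<longrightarrow> \<phi> z = 0))"

text \<open>\<open>p\<close> and \<open>q\<close> are the distributional partial derivatives of \<open>f\<close>.\<close>

definition W12_loc :: "complex set \<Rightarrow> (complex \<Rightarrow> complex) \<Rightarrow> bool" where
  "W12_loc U f \<longleftrightarrow> L2_loc U f \<and>
     (\<exists>p q. L2_loc U p \<and> L2_loc U q \<and>
        (\<forall>\<phi>. test_function U \<phi> \<longrightarrow>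
           set_lebesgue_integral lebesgue U (\<lambda>z. pdx \<phi> z *\<^sub>R f z) =
             - set_lebesgue_integral lebesgue U (\<lambda>z. \<phi> z *\<^sub>R p z) \<and>
           set_lebesgue_integral lebesgue U (\<lambda>z. pdy \<phi> z *\<^sub>R f z) =
             - set_lebesgue_integral lebesgue U (\<lambda>z. \<phi> z *\<^sub>R q z)))"

text \<open>
  A homeomorphism in \<open>W\<^sup>1\<^sup>,\<^sup>2\<^sub>l\<^sub>o\<^sub>c\<close> has classical partial derivatives only almost everywhere
  (where they agree with the distributional ones), so the dilatation inequality is required
  almost everywhere; for harmonic maps this is the same as everywhere, by continuity.
\<close>

definition quasiconformal ::
    "real \<Rightarrow> complex set \<Rightarrow> complex set \<Rightarrow> (complex \<Rightarrow> complex) \<Rightarrow> bool" where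
  "quasiconformal K U V f \<longleftrightarrow>
     1 \<le> K \<and>
     open U \<and> connected U \<and> U \<noteq> {} \<and> open V \<and> connected V \<and> V \<noteq> {} \<and>
     (\<exists>g. homeomorphism U V f g) \<and> sense_preserving_on U f \<and> W12_loc U f \<and>
     (AE z in lebesgue. z \<in> U \<longrightarrow> (D_norm f z)\<^sup>2 \<le> K * D_det f z)"

section \<open>Pommerenke interior domains\<close>

text \<open>Length of a curve as the supremum of the lengths of its inscribed polygons.\<close>

definition curve_length :: "(real \<Rightarrow> complex) \<Rightarrow> ennreal" where
  "curve_length \<gamma> =
     (SUP ts \<in> {ts. sorted ts \<and> set ts \<subseteq> {0..1}}.
        ennreal (\<Sum>i<length ts - 1. dist (\<gamma> (ts ! i)) (\<gamma> (ts ! Suc i))))"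

text \<open>
  For distinct points \<open>w\<^sub>1, w\<^sub>2\<close> of the Jordan curve \<open>f(\<partial>\<D>\<^sub>r)\<close>, the set below consists of (shifts by
  \<open>2\<pi>\<close> of) parametrisations from \<open>w\<^sub>1\<close> to \<open>w\<^sub>2\<close> of precisely the two complementary subarcs, as the
  angle \<open>t - s\<close> is determined up to the choice between one value in \<open>(0, 2\<pi>)\<close> and one in
  \<open>(-2\<pi>, 0)\<close>. The length of the smaller subarc is thus the minimum of the two lengths.
\<close>

definition subarcs ::
    "(complex \<Rightarrow> complex) \<Rightarrow> real \<Rightarrow> complex \<Rightarrow> complex \<Rightarrow> (real \<Rightarrow> complex) set" where
  "subarcs f r w1 w2 =
     {f \<circ> part_circlepath 0 r s t | s t.
        f (r * cis s) = w1 \<and> f (r * cis t) = w2 \<and> \<bar>t - s\<bar> < 2 * pi}"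

definition smaller_subarc_length ::
    "(complex \<Rightarrow> complex) \<Rightarrow> real \<Rightarrow> complex \<Rightarrow> complex \<Rightarrow> ennreal" where
  "smaller_subarc_length f r w1 w2 = (INF \<gamma> \<in> subarcs f r w1 w2. curve_length \<gamma>)"

definition inner_diam_dist :: "complex set \<Rightarrow> complex \<Rightarrow> complex \<Rightarrow> ennreal" where
  "inner_diam_dist \<Omega> w1 w2 =
     (INF \<Gamma> \<in> {\<Gamma>. arc \<Gamma> \<and> pathstart \<Gamma> = w1 \<and> pathfinish \<Gamma> = w2 \<and>
                   path_image \<Gamma> - {w1, w2} \<subseteq> \<Omega>}.
        ennreal (diameter (path_image \<Gamma>)))"

definition pommerenke_interior_domain :: "(complex \<Rightarrow> complex) \<Rightarrow> complex set \<Rightarrow> bool" where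
  "pommerenke_interior_domain f G \<longleftrightarrow>
     f ` ball 0 1 = G \<and>
     (SUP r \<in> {0<..<1}.
        SUP (w1, w2) \<in> {(w1, w2). w1 \<in> f ` sphere 0 r \<and> w2 \<in> f ` sphere 0 r \<and> w1 \<noteq> w2}.
          smaller_subarc_length f r w1 w2 / inner_diam_dist (f ` ball 0 r) w1 w2) < \<infinity>"

section \<open>Generalized Hardy space\<close>

definition M1 :: "real \<Rightarrow> (complex \<Rightarrow> complex) \<Rightarrow> real" where
  "M1 r F = 1 / (2 * pi) * set_lebesgue_integral lebesgue {0..2 * pi} (\<lambda>\<theta>. norm (F (r * cis \<theta>)))"

definition H1_g :: "(complex \<Rightarrow> complex) set" where
  "H1_g = {F. F \<in> borel_measurable (lebesgue_on (ball 0 1)) \<and>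
              (\<forall>r\<in>{0<..<1}. set_integrable lebesgue {0..2 * pi} (\<lambda>\<theta>. norm (F (r * cis \<theta>)))) \<and>
              bdd_above ((\<lambda>r. M1 r F) ` {0<..<1})}"

end

theory Submission
  imports Defs
begin

text \<open>
  The idea is that the length of the image curves of the circles of radius \<open>r\<close> stays bounded as
  \<open>r \<rightarrow> 1\<close>, and that for a quasiconformal map this length controls the circular mean of the
  maximal stretching \<open>\<parallel>D\<^sub>f\<parallel>\<close>.

  For the first part, join two points of \<open>f(\<partial>\<D>\<^sub>r)\<close> by the image of the chord between their
  preimages. This arc runs inside \<open>f(\<D>\<^sub>r)\<close>, so the inner distance of the two points is at most the
  diameter of the bounded domain \<open>G\<close>, and the Pommerenke condition bounds the shorter of the two
  subarcs between them by a constant \<open>L\<close>, whatever the points and whatever \<open>r\<close>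
  (\<open>pommerenke_smaller_subarc_bounded\<close>). Applied to two points that halve the
  length of the curve, where the shorter subarc is half of the curve, this gives a total length of
  at most \<open>2 L\<close> (\<open>circle_image_length_le\<close>).

  For the second part, write \<open>f = h + cnj g\<close>, so that \<open>\<parallel>D\<^sub>f\<parallel> = \<bar>h'\<bar> + \<bar>g'\<bar>\<close>. The derivative of
  \<open>\<theta> \<mapsto> f (r cis \<theta>)\<close> has modulus at least \<open>r (\<bar>h'\<bar> - \<bar>g'\<bar>)\<close>, and quasiconformality gives
  \<open>\<parallel>D\<^sub>f\<parallel> \<le> K (\<bar>h'\<bar> - \<bar>g'\<bar>)\<close>. Integration over the circle yields
  \<open>r \<integral> \<parallel>D\<^sub>f\<parallel> d\<theta> \<le> 2 K L\<close>, which bounds the means for \<open>r > 1/2\<close>; for \<open>r \<le> 1/2\<close> they are bounded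
  because \<open>\<parallel>D\<^sub>f\<parallel>\<close> is continuous on a compact disc.

  The length of a curve is a supremum over inscribed polygons; it enters through the inequality
  that the integral of the speed of a continuously differentiable curve is at most its length
  (\<open>integral_norm_deriv_le_curve_length\<close>).
\<close>

section \<open>Length of continuously differentiable curves\<close>

text \<open>
  On a short interval the derivative is nearly constant, so the curve is nearly its chord. Comparing
  both the chord and the integral of the speed with \<open>(b - a) * norm (\<gamma>' a)\<close> costs one error term
  \<open>\<epsilon> * (b - a)\<close> each.
\<close>

lemma integral_norm_deriv_le_dist:
  fixes \<gamma> \<gamma>' :: "real \<Rightarrow> complex"
  assumes "a \<le> b" and "\<epsilon> \<ge> 0"
    and deriv: "\<And>x. x \<in> {a..b} \<Longrightarrow> (\<gamma> has_vector_derivative \<gamma>' x) (at x within {a..b})"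
    and cont: "continuous_on {a..b} \<gamma>'"
    and osc: "\<And>x. x \<in> {a..b} \<Longrightarrow> norm (\<gamma>' x - \<gamma>' a) \<le> \<epsilon>"
  shows "integral {a..b} (\<lambda>x. norm (\<gamma>' x)) \<le> dist (\<gamma> a) (\<gamma> b) + 2 * \<epsilon> * (b - a)"
proof -
  have "(\<gamma>' has_integral (\<gamma> b - \<gamma> a)) {a..b}"
    using fundamental_theorem_of_calculus[OF \<open>a \<le> b\<close>] deriv by blast
  moreover have "((\<lambda>x. \<gamma>' a) has_integral (b - a) *\<^sub>R \<gamma>' a) {a..b}"
    using has_integral_const_real[of "\<gamma>' a" a b] \<open>a \<le> b\<close> by simp
  ultimately have "((\<lambda>x. \<gamma>' x - \<gamma>' a) has_integral (\<gamma> b - \<gamma> a - (b - a) *\<^sub>R \<gamma>' a)) {a..b}"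
    by (rule has_integral_diff)
  then have "norm (\<gamma> b - \<gamma> a - (b - a) *\<^sub>R \<gamma>' a) \<le> \<epsilon> * (b - a)"
    using has_integral_bound_real[OF \<open>\<epsilon> \<ge> 0\<close>, of "{}" "\<lambda>x. \<gamma>' x - \<gamma>' a" _ a b] osc \<open>a \<le> b\<close>
    by simp
  moreover have "(b - a) * norm (\<gamma>' a) = norm ((b - a) *\<^sub>R \<gamma>' a)"
    using \<open>a \<le> b\<close> by simp
  ultimately have chord: "(b - a) * norm (\<gamma>' a) \<le> dist (\<gamma> a) (\<gamma> b) + \<epsilon> * (b - a)"
    unfolding dist_norm by (smt (verit) norm_minus_commute norm_triangle_ineq2)
  have "integral {a..b} (\<lambda>x. norm (\<gamma>' x)) \<le> integral {a..b} (\<lambda>x. norm (\<gamma>' a) + \<epsilon>)"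
  proof (rule integral_le)
    show "norm (\<gamma>' x) \<le> norm (\<gamma>' a) + \<epsilon>" if "x \<in> {a..b}" for x
      using osc[OF that] norm_triangle_ineq2[of "\<gamma>' x" "\<gamma>' a"] by linarith
  qed (auto intro!: integrable_continuous_real continuous_intros cont)
  also have "\<dots> = (b - a) * norm (\<gamma>' a) + \<epsilon> * (b - a)"
    using \<open>a \<le> b\<close> by (simp add: algebra_simps)
  finally show ?thesis using chord by linarith
qed

lemma integral_uniform_partition:
  fixes \<phi> :: "real \<Rightarrow> real"
  assumes "n > 0" and cont: "continuous_on {0..1} \<phi>"
  shows "integral {0..1} \<phi> = (\<Sum>i<n. integral {real i / n..real (Suc i) / n} \<phi>)"
proof -
  have "integral {0..real k / n} \<phi> = (\<Sum>i<k. integral {real i / n..real (Suc i) / n} \<phi>)"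
    if "k \<le> n" for k
    using that
  proof (induction k)
    case (Suc k)
    have "\<phi> integrable_on {0..real (Suc k) / n}"
      using Suc.prems \<open>n > 0\<close>
      by (intro integrable_continuous_real continuous_on_subset[OF cont]) auto
    from Henstock_Kurzweil_Integration.integral_combine[OF _ _ this, of "real k / n"] Suc \<open>n > 0\<close>
    show ?case by (simp add: divide_right_mono)
  qed simp
  from this[of n] \<open>n > 0\<close> show ?thesis by simp
qed

lemma inscribed_uniform_polygon_le_curve_length:
  assumes "n > 0"
  shows "ennreal (\<Sum>i<n. dist (\<gamma> (real i / n)) (\<gamma> (real (Suc i) / n))) \<le> curve_length \<gamma>"
proof -
  let ?ts = "map (\<lambda>i. real i / real n) [0..<Suc n]"
  have nth: "?ts ! i = real i / n" if "i < Suc n" for i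
    using that by (simp add: nth_append del: upt_Suc)
  have "sorted ?ts"
    by (simp add: sorted_iff_nth_mono divide_right_mono del: upt_Suc)
  moreover have "set ?ts \<subseteq> {0..1}" using \<open>n > 0\<close> by auto
  ultimately have "ennreal (\<Sum>i<length ?ts - 1. dist (\<gamma> (?ts ! i)) (\<gamma> (?ts ! Suc i)))
      \<le> curve_length \<gamma>"
    unfolding curve_length_def by (intro SUP_upper) blast
  moreover have "(\<Sum>i<length ?ts - 1. dist (\<gamma> (?ts ! i)) (\<gamma> (?ts ! Suc i)))
      = (\<Sum>i<n. dist (\<gamma> (real i / n)) (\<gamma> (real (Suc i) / n)))"
    by (intro sum.cong) (auto simp: nth simp del: upt_Suc)
  ultimately show ?thesis by (simp only:)
qed

text \<open>
  Uniform continuity of the derivative makes the chord comparison hold on every piece of a fine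
  uniform partition; the errors add up to an arbitrarily small amount.
\<close>

lemma integral_norm_deriv_le_curve_length:
  fixes \<gamma> \<gamma>' :: "real \<Rightarrow> complex"
  assumes deriv: "\<And>x. x \<in> {0..1} \<Longrightarrow> (\<gamma> has_vector_derivative \<gamma>' x) (at x within {0..1})"
    and cont: "continuous_on {0..1} \<gamma>'"
  shows "ennreal (integral {0..1} (\<lambda>x. norm (\<gamma>' x))) \<le> curve_length \<gamma>"
proof (rule ennreal_le_epsilon)
  fix e :: real assume "e > 0"
  \<comment> \<open>each piece of length \<open>1 / n\<close> contributes an error \<open>2 * \<epsilon> / n\<close>, hence \<open>e\<close> in total\<close>
  define \<epsilon> where "\<epsilon> = e / 2"
  have "\<epsilon> > 0" using \<open>e > 0\<close> by (simp add: \<epsilon>_def)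
  have "uniformly_continuous_on {0..1} \<gamma>'"
    using cont by (simp add: compact_uniformly_continuous)
  then obtain d where "d > 0"
    and d: "\<And>x y. \<lbrakk>x \<in> {0..1}; y \<in> {0..1}; dist y x < d\<rbrakk> \<Longrightarrow> dist (\<gamma>' y) (\<gamma>' x) < \<epsilon>"
    using \<open>\<epsilon> > 0\<close> unfolding uniformly_continuous_on_def by metis
  obtain n :: nat where n: "n > 0" "1 / real n < d"
    using \<open>d > 0\<close> by (metis nat_approx_posE inverse_eq_divide of_nat_0_less_iff zero_less_Suc)
  have piece: "integral {real i / n..real (Suc i) / n} (\<lambda>x. norm (\<gamma>' x))
      \<le> dist (\<gamma> (real i / n)) (\<gamma> (real (Suc i) / n)) + e / n" if "i < n" for i
  proof -
    let ?a = "real i / n" and ?b = "real (Suc i) / n"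
    have ab: "?b - ?a = 1 / n" by (simp add: diff_divide_distrib[symmetric])
    have "0 \<le> ?a" "?a \<le> ?b" "?b \<le> 1" using that n by (auto simp: divide_right_mono)
    then have sub: "{?a..?b} \<subseteq> {0..1}" by (meson atLeastatMost_subset_iff)
    have "norm (\<gamma>' x - \<gamma>' ?a) \<le> \<epsilon>" if "x \<in> {?a..?b}" for x
    proof -
      have "dist x ?a < d" using that ab n(2) by (auto simp: dist_real_def)
      moreover have "?a \<in> {0..1}" using \<open>0 \<le> ?a\<close> \<open>?a \<le> ?b\<close> \<open>?b \<le> 1\<close> by auto
      moreover have "x \<in> {0..1}" using that sub by blast
      ultimately show ?thesis using d[of ?a x] by (simp only: dist_norm less_imp_le)
    qed
    then have "integral {?a..?b} (\<lambda>x. norm (\<gamma>' x))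
        \<le> dist (\<gamma> ?a) (\<gamma> ?b) + 2 * \<epsilon> * (?b - ?a)"
      using \<open>\<epsilon> > 0\<close> \<open>?a \<le> ?b\<close>
      by (intro integral_norm_deriv_le_dist continuous_on_subset[OF cont sub]
            has_vector_derivative_within_subset[OF deriv sub] subsetD[OF sub]) auto
    then show ?thesis unfolding ab by (simp add: \<epsilon>_def)
  qed
  have "integral {0..1} (\<lambda>x. norm (\<gamma>' x))
      \<le> (\<Sum>i<n. dist (\<gamma> (real i / n)) (\<gamma> (real (Suc i) / n)) + e / n)"
    using sum_mono[of "{..<n}", OF piece]
    by (simp add: integral_uniform_partition[OF n(1)] cont continuous_on_norm)
  also have "\<dots> = (\<Sum>i<n. dist (\<gamma> (real i / n)) (\<gamma> (real (Suc i) / n))) + e"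
    using n(1) by (simp add: sum.distrib)
  finally have "ennreal (integral {0..1} (\<lambda>x. norm (\<gamma>' x)))
      \<le> ennreal (\<Sum>i<n. dist (\<gamma> (real i / n)) (\<gamma> (real (Suc i) / n))) + ennreal e"
    using \<open>e > 0\<close> by (subst ennreal_plus[symmetric]) (auto intro!: ennreal_leI sum_nonneg)
  also have "\<dots> \<le> curve_length \<gamma> + ennreal e"
    by (intro add_mono inscribed_uniform_polygon_le_curve_length n order_refl)
  finally show "ennreal (integral {0..1} (\<lambda>x. norm (\<gamma>' x))) \<le> curve_length \<gamma> + ennreal e" .
qed

text \<open>
  The form needed for arcs of a circle: the segment from \<open>a\<close> to \<open>b\<close> may be traversed in either
  direction, since the two arcs between two points of a circle have opposite orientations.
\<close>

lemma integral_norm_deriv_le_curve_length_linepath: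
  fixes c c' :: "real \<Rightarrow> complex"
  assumes deriv: "\<And>u. (c has_vector_derivative c' u) (at u)"
    and cont: "continuous_on UNIV c'"
    and "a \<noteq> b"
  shows "ennreal (integral (closed_segment a b) (\<lambda>u. norm (c' u)))
      \<le> curve_length (\<lambda>x. c (linepath a b x))"
proof -
  let ?m = "b - a" and ?I = "integral (closed_segment a b) (\<lambda>u. norm (c' u))"
  let ?\<gamma>' = "\<lambda>x. ?m *\<^sub>R c' (?m *\<^sub>R x + a)"
  have line: "linepath a b = (\<lambda>x. ?m *\<^sub>R x + a)"
    by (auto simp: linepath_def algebra_simps)
  define lo hi where "lo = min a b" and "hi = max a b"
  have seg: "closed_segment a b = cbox lo hi"
    by (auto simp: closed_segment_eq_real_ivl lo_def hi_def)
  have "((\<lambda>u. norm (c' u)) has_integral ?I) (cbox lo hi)"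
    unfolding seg
    by (intro integrable_integral integrable_continuous continuous_intros
          continuous_on_subset[OF cont]) auto
  from has_integral_affinity[OF this, of ?m a]
  have "((\<lambda>x. norm (c' (?m *\<^sub>R x + a))) has_integral (1 / \<bar>?m\<bar>) *\<^sub>R ?I)
      ((\<lambda>x. (1 / ?m) *\<^sub>R x + - ((1 / ?m) *\<^sub>R a)) ` cbox lo hi)"
    using \<open>a \<noteq> b\<close> by simp
  moreover have "(\<lambda>x. (1 / ?m) *\<^sub>R x + - ((1 / ?m) *\<^sub>R a)) ` cbox lo hi = {0..1}"
  proof -
    have line_image: "cbox lo hi = (\<lambda>x. ?m *\<^sub>R x + a) ` {0..1}"
      using seg linepath_image_01[of a b] unfolding line by simp
    have "(\<lambda>x. (1 / ?m) *\<^sub>R x + - ((1 / ?m) *\<^sub>R a)) ` cbox lo hi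
        = (\<lambda>x. (1 / ?m) *\<^sub>R (?m *\<^sub>R x + a) + - ((1 / ?m) *\<^sub>R a)) ` {0..1}"
      unfolding line_image image_image ..
    also have "(\<lambda>x. (1 / ?m) *\<^sub>R (?m *\<^sub>R x + a) + - ((1 / ?m) *\<^sub>R a)) = (\<lambda>x. x)"
      using \<open>a \<noteq> b\<close> by (auto simp: add_divide_distrib)
    finally show ?thesis by simp
  qed
  ultimately have "((\<lambda>x. norm (c' (?m *\<^sub>R x + a))) has_integral (1 / \<bar>?m\<bar>) *\<^sub>R ?I) {0..1}"
    by (simp only:)
  from has_integral_mult_right[OF this, of "\<bar>?m\<bar>"]
  have "((\<lambda>x. norm (?\<gamma>' x)) has_integral ?I) {0..1}"
    using \<open>a \<noteq> b\<close> by simp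
  then have "integral {0..1} (\<lambda>x. norm (?\<gamma>' x)) = ?I" by (rule integral_unique)
  moreover have "ennreal (integral {0..1} (\<lambda>x. norm (?\<gamma>' x)))
      \<le> curve_length (\<lambda>x. c (linepath a b x))"
  proof (rule integral_norm_deriv_le_curve_length)
    have "((\<lambda>x. ?m *\<^sub>R x + a) has_vector_derivative ?m) (at x within {0..1})" for x
      by (auto intro!: derivative_eq_intros)
    from vector_diff_chain_within[OF this has_vector_derivative_at_within[OF deriv]]
    show "((\<lambda>x. c (linepath a b x)) has_vector_derivative ?\<gamma>' x) (at x within {0..1})" for x
      unfolding line by (simp add: o_def)
    show "continuous_on {0..1} ?\<gamma>'"
      by (intro continuous_intros continuous_on_compose2[OF cont]) auto
  qed
  ultimately show ?thesis by simp
qed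

section \<open>Images of circles bounding a Pommerenke interior domain\<close>

text \<open>
  The image of the chord from \<open>z1\<close> to \<open>z2\<close> is an admissible arc: by strict convexity of the disc
  the open chord lies in the open disc of radius \<open>r\<close>.
\<close>

lemma inner_diam_dist_le_diameter:
  fixes f :: "complex \<Rightarrow> complex"
  assumes inj: "inj_on f (ball 0 1)" and cont: "continuous_on (ball 0 1) f"
    and bdd: "bounded (f ` ball 0 1)"
    and z: "norm z1 = r" "norm z2 = r" and "r < 1" and "z1 \<noteq> z2"
  shows "inner_diam_dist (f ` ball 0 r) (f z1) (f z2) \<le> ennreal (diameter (f ` ball 0 1))"
proof -
  define \<Gamma> where "\<Gamma> = f \<circ> linepath z1 z2"
  have seg: "closed_segment z1 z2 \<subseteq> ball 0 1"
    using z \<open>r < 1\<close> by (intro closed_segment_subset) auto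
  have "arc \<Gamma>"
    unfolding \<Gamma>_def arc_def
  proof
    show "path (f \<circ> linepath z1 z2)"
      using seg by (intro path_continuous_image) (auto intro: continuous_on_subset[OF cont])
    have "inj_on f (linepath z1 z2 ` {0..1})"
      using inj_on_subset[OF inj seg] by (simp add: linepath_image_01)
    moreover have "inj_on (linepath z1 z2) {0..1}"
      using \<open>z1 \<noteq> z2\<close> arc_linepath arc_def by blast
    ultimately show "inj_on (f \<circ> linepath z1 z2) {0..1}" by (simp add: comp_inj_on)
  qed
  have image: "path_image \<Gamma> = f ` closed_segment z1 z2"
    by (simp add: \<Gamma>_def path_image_compose)
  have "open_segment z1 z2 \<subseteq> ball 0 r"
    using dist_decreases_open_segment[of _ z1 z2 0] z by auto
  then have "path_image \<Gamma> - {f z1, f z2} \<subseteq> f ` ball 0 r"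
    unfolding image closed_segment_eq_open by auto
  with \<open>arc \<Gamma>\<close> have "inner_diam_dist (f ` ball 0 r) (f z1) (f z2)
      \<le> ennreal (diameter (path_image \<Gamma>))"
    unfolding inner_diam_dist_def
    by (intro INF_lower) (auto simp: \<Gamma>_def pathstart_compose pathfinish_compose)
  also have "\<dots> \<le> ennreal (diameter (f ` ball 0 1))"
    unfolding image using seg by (intro ennreal_leI diameter_subset bdd image_mono)
  finally show ?thesis .
qed

text \<open>
  The bound is the Pommerenke constant times the diameter of \<open>G\<close>.
\<close>

lemma pommerenke_smaller_subarc_bounded:
  assumes pom: "pommerenke_interior_domain f G" and "bounded G"
    and inj: "inj_on f (ball 0 1)" and cont: "continuous_on (ball 0 1) f"
  obtains L where "L \<ge> 0"
    and "\<And>r z1 z2. \<lbrakk>0 < r; r < 1; norm z1 = r; norm z2 = r; z1 \<noteq> z2\<rbrakk>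
           \<Longrightarrow> smaller_subarc_length f r (f z1) (f z2) \<le> ennreal L"
proof -
  define C where "C = (SUP r \<in> {0<..<1}.
        SUP (w1, w2) \<in> {(w1, w2). w1 \<in> f ` sphere 0 r \<and> w2 \<in> f ` sphere 0 r \<and> w1 \<noteq> w2}.
          smaller_subarc_length f r w1 w2 / inner_diam_dist (f ` ball 0 r) w1 w2)"
  have G: "G = f ` ball 0 1" and "C < top"
    using pom by (auto simp: pommerenke_interior_domain_def C_def)
  define L where "L = enn2real C * diameter G"
  have "L \<ge> 0" using \<open>bounded G\<close> by (simp add: L_def diameter_ge_0)
  moreover have "smaller_subarc_length f r (f z1) (f z2) \<le> ennreal L"
    if r: "0 < r" "r < 1" and z: "norm z1 = r" "norm z2 = r" "z1 \<noteq> z2" for r z1 z2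
  proof -
    let ?l = "smaller_subarc_length f r (f z1) (f z2)"
      and ?d = "inner_diam_dist (f ` ball 0 r) (f z1) (f z2)"
    have "f z1 \<noteq> f z2" using inj z r by (auto dest: inj_onD)
    then have mem: "(f z1, f z2)
        \<in> {(w1, w2). w1 \<in> f ` sphere 0 r \<and> w2 \<in> f ` sphere 0 r \<and> w1 \<noteq> w2}"
      using z by auto
    have "?l / ?d \<le> (SUP (w1, w2) \<in> {(w1, w2). w1 \<in> f ` sphere 0 r \<and> w2 \<in> f ` sphere 0 r
          \<and> w1 \<noteq> w2}. smaller_subarc_length f r w1 w2 / inner_diam_dist (f ` ball 0 r) w1 w2)"
      using SUP_upper[OF mem, of "\<lambda>(w1, w2). smaller_subarc_length f r w1 w2
          / inner_diam_dist (f ` ball 0 r) w1 w2"] by simp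
    also have "\<dots> \<le> C"
      unfolding C_def using r by (intro SUP_upper) auto
    finally have quot: "?l / ?d \<le> C" .
    have d: "?d \<le> ennreal (diameter G)"
      unfolding G
      by (rule inner_diam_dist_le_diameter) (use inj cont \<open>bounded G\<close> G z r in auto)
    have "?l \<le> C * ?d"
    \<comment> \<open>in \<open>ennreal\<close> a positive number divided by \<open>0\<close> is \<open>\<infinity>\<close>, so the quotient bound also covers
      \<open>?d = 0\<close>\<close>
    proof (cases "?d = 0")
      case True
      then have "?l = 0" using quot \<open>C < top\<close>
        by (metis ennreal_divide_eq_top_iff leD)
      then show ?thesis by simp
    next
      case False
      have "?d < top" using d by (metis ennreal_less_top le_less_trans)
      then have "?l = ?l / ?d * ?d"
        using False by (simp add: ennreal_divide_times ennreal_divide_self)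
      also have "\<dots> \<le> C * ?d" using quot by (intro mult_right_mono) auto
      finally show ?thesis .
    qed
    also have "\<dots> \<le> C * ennreal (diameter G)" using d by (intro mult_left_mono) auto
    also have "\<dots> = ennreal L"
      using \<open>C < top\<close> \<open>bounded G\<close> by (simp add: L_def ennreal_mult diameter_ge_0)
    finally show ?thesis .
  qed
  ultimately show ?thesis by (rule that)
qed

text \<open>
  Up to rotation by full turns, which does not change the curve, the parameter interval ends at
  \<open>\<alpha>\<close>. It can only start at \<open>0\<close> (anticlockwise arc) or at \<open>2 * pi\<close> (clockwise arc), because its
  length is less than \<open>2 * pi\<close>.
\<close>

lemma two_arcs_between_points_of_circle:
  assumes \<gamma>: "\<gamma> \<in> subarcs f r (f (of_real r)) (f (r * cis \<alpha>))"
    and inj: "inj_on f (sphere 0 r)" and "r > 0" and "0 < \<alpha>" "\<alpha> < 2 * pi"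
  obtains a where "a = 0 \<or> a = 2 * pi" and "\<gamma> = (\<lambda>x. f (r * cis (linepath a \<alpha> x)))"
proof -
  obtain s t where \<gamma>_eq: "\<gamma> = f \<circ> part_circlepath 0 r s t"
    and s: "f (r * cis s) = f (of_real r)" and t: "f (r * cis t) = f (r * cis \<alpha>)"
    and st: "\<bar>t - s\<bar> < 2 * pi"
    using \<gamma> by (auto simp: subarcs_def)
  have cs: "cis s = cis 0" using inj_onD[OF inj s] \<open>r > 0\<close> by (auto simp: norm_mult)
  have ct: "cis t = cis \<alpha>" using inj_onD[OF inj t] \<open>r > 0\<close> by (auto simp: norm_mult)
  obtain k :: int where k: "s = 2 * pi * k"
    using cs sin_cos_eq_iff[of s 0] by (auto simp: complex_eq_iff)
  obtain l :: int where l: "t = \<alpha> + 2 * pi * l"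
    using ct sin_cos_eq_iff[of t \<alpha>] by (auto simp: complex_eq_iff)
  define m where "m = k - l"
  have ts: "t - s = \<alpha> - 2 * pi * m" unfolding k l m_def by (simp add: algebra_simps)
  have "2 * pi * (- 1) < 2 * pi * of_int m" "2 * pi * of_int m < 2 * pi * 2"
    using st \<open>0 < \<alpha>\<close> \<open>\<alpha> < 2 * pi\<close> unfolding ts by linarith+
  then have "- 1 < real_of_int m" "real_of_int m < 2"
    by (simp_all only: mult_less_cancel_left_pos[of "2 * pi"] mult_pos_pos pi_gt_zero zero_less_numeral)
  then have m: "m = 0 \<or> m = 1" by linarith
  have "\<gamma> x = f (r * cis (linepath (2 * pi * m) \<alpha> x))" for x
  proof -
    have "linepath s t x = linepath (2 * pi * m) \<alpha> x + 2 * pi * of_int l"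
      unfolding linepath_def l k m_def by (simp add: algebra_simps)
    then have "cis (linepath s t x) = cis (linepath (2 * pi * m) \<alpha> x)"
      by (simp add: cis_mult[symmetric])
    then show ?thesis by (simp add: \<gamma>_eq part_circlepath_def cis_conv_exp)
  qed
  then show ?thesis using m by (intro that[of "2 * pi * m"]) auto
qed

text \<open>
  By the intermediate value theorem some \<open>\<alpha>\<close> halves the integral \<open>T\<close> of the speed. Both arcs
  between the points with arguments \<open>0\<close> and \<open>\<alpha>\<close> then have length at least \<open>T / 2\<close>, and so has the
  shorter one.
\<close>

lemma circle_image_length_le:
  fixes f :: "complex \<Rightarrow> complex" and c' :: "real \<Rightarrow> complex"
  assumes deriv: "\<And>\<theta>. ((\<lambda>\<theta>. f (r * cis \<theta>)) has_vector_derivative c' \<theta>) (at \<theta>)"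
    and cont: "continuous_on UNIV c'"
    and inj: "inj_on f (sphere 0 r)" and "r > 0" and "L \<ge> 0"
    and bound: "\<And>z1 z2. \<lbrakk>norm z1 = r; norm z2 = r; z1 \<noteq> z2\<rbrakk>
           \<Longrightarrow> smaller_subarc_length f r (f z1) (f z2) \<le> ennreal L"
  shows "integral {0..2 * pi} (\<lambda>\<theta>. norm (c' \<theta>)) \<le> 2 * L"
proof (cases "integral {0..2 * pi} (\<lambda>\<theta>. norm (c' \<theta>)) = 0")
  case False
  define T where "T = integral {0..2 * pi} (\<lambda>\<theta>. norm (c' \<theta>))"
  have int: "(\<lambda>\<theta>. norm (c' \<theta>)) integrable_on {a..b}" for a b
    by (intro integrable_continuous_real continuous_intros continuous_on_subset[OF cont]) auto
  have "T > 0"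
    using False integral_nonneg[OF int[of 0 "2 * pi"]] by (simp add: T_def less_le)
  have "\<exists>\<alpha>\<ge>0. \<alpha> \<le> 2 * pi \<and> integral {0..\<alpha>} (\<lambda>\<theta>. norm (c' \<theta>)) = T / 2"
    using \<open>T > 0\<close>
    by (intro IVT' indefinite_integral_continuous_1 int) (auto simp: T_def)
  then obtain \<alpha> where \<alpha>: "0 \<le> \<alpha>" "\<alpha> \<le> 2 * pi"
    and half: "integral {0..\<alpha>} (\<lambda>\<theta>. norm (c' \<theta>)) = T / 2" by blast
  have "\<alpha> \<noteq> 0" "\<alpha> \<noteq> 2 * pi" using half \<open>T > 0\<close> by (auto simp: T_def)
  with \<alpha> have \<alpha>': "0 < \<alpha>" "\<alpha> < 2 * pi" by auto
  have other_half: "integral {\<alpha>..2 * pi} (\<lambda>\<theta>. norm (c' \<theta>)) = T / 2"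
    using Henstock_Kurzweil_Integration.integral_combine[OF \<alpha> int] half by (simp add: T_def)
  have "cis \<alpha> \<noteq> 1"
  proof
    assume "cis \<alpha> = 1"
    then obtain n :: int where n: "\<alpha> = 2 * pi * n"
      using sin_cos_eq_iff[of \<alpha> 0] by (auto simp: complex_eq_iff)
    then have "0 < real_of_int n" "real_of_int n < 1"
      using \<alpha>' by (auto simp: zero_less_mult_iff)
    then show False by simp
  qed
  then have ne: "complex_of_real r \<noteq> r * cis \<alpha>" using \<open>r > 0\<close> by auto
  have "ennreal (T / 2) \<le> smaller_subarc_length f r (f (of_real r)) (f (r * cis \<alpha>))"
    unfolding smaller_subarc_length_def
  proof (rule INF_greatest)
    fix \<gamma> assume "\<gamma> \<in> subarcs f r (f (of_real r)) (f (r * cis \<alpha>))"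
    from this inj \<open>r > 0\<close> \<alpha>' obtain a where a: "a = 0 \<or> a = 2 * pi"
      and \<gamma>: "\<gamma> = (\<lambda>x. f (r * cis (linepath a \<alpha> x)))"
      by (rule two_arcs_between_points_of_circle)
    have "integral (closed_segment a \<alpha>) (\<lambda>\<theta>. norm (c' \<theta>)) = T / 2"
      using a \<alpha> half other_half by (auto simp: closed_segment_eq_real_ivl)
    moreover have "a \<noteq> \<alpha>" using a \<alpha>' by auto
    ultimately show "ennreal (T / 2) \<le> curve_length \<gamma>"
      using integral_norm_deriv_le_curve_length_linepath[OF deriv cont, of a \<alpha>] unfolding \<gamma> by metis
  qed
  also have "\<dots> \<le> ennreal L" using ne \<open>r > 0\<close> by (intro bound) (auto simp: norm_mult)
  finally show ?thesis using \<open>L \<ge> 0\<close> by (simp add: T_def)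
qed (use \<open>L \<ge> 0\<close> in auto)

section \<open>Derivatives of harmonic mappings\<close>

lemma has_derivative_plus_cnj:
  assumes "(h has_field_derivative h') (at z)" "(g has_field_derivative g') (at z)"
  shows "((\<lambda>w. h w + cnj (g w)) has_derivative (\<lambda>v. h' * v + cnj (g' * v))) (at z)"
  by (rule has_derivative_add[OF _ has_derivative_cnj])
    (use assms in \<open>simp_all add: has_field_derivative_def\<close>)

lemma Wirtinger_derivatives_plus_cnj:
  assumes "(h has_field_derivative h') (at z)" "(g has_field_derivative g') (at z)"
    and "open U" "z \<in> U" and f: "\<And>w. w \<in> U \<Longrightarrow> f w = h w + cnj (g w)"
  shows "D_z f z = h'" and "D_zbar f z = cnj g'"
proof -
  have D: "(f has_derivative (\<lambda>v. h' * v + cnj (g' * v))) (at z)"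
    by (rule has_derivative_transform_within_open[OF has_derivative_plus_cnj[OF assms(1,2)]
          \<open>open U\<close> \<open>z \<in> U\<close>]) (simp add: f)
  have line: "((\<lambda>u. f (p u)) has_vector_derivative (h' * v + cnj (g' * v))) (at a)"
    if "p a = z" "(p has_vector_derivative v) (at a)" for p a v
    using vector_derivative_diff_chain_within[OF that(2) has_derivative_at_withinI, of f] D that(1)
    by (simp add: o_def)
  have "((\<lambda>x. Complex x (Im z)) has_vector_derivative 1) (at (Re z))"
    and "((\<lambda>y. Complex (Re z) y) has_vector_derivative \<i>) (at (Im z))"
    unfolding has_vector_derivative_def Complex_eq scaleR_conv_of_real
    by (auto intro!: derivative_eq_intros)
  then have x: "pdx f z = h' + cnj g'" and y: "pdy f z = \<i> * h' - \<i> * cnj g'"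
    unfolding pdx_def pdy_def
    using line[of "\<lambda>x. Complex x (Im z)" "Re z" 1] line[of "\<lambda>y. Complex (Re z) y" "Im z" \<i>]
    by (auto intro!: vector_derivative_at simp: mult.commute)
  show "D_z f z = h'" "D_zbar f z = cnj g'"
    by (simp_all add: D_z_def D_zbar_def x y right_diff_distrib mult.assoc[symmetric])
qed

text \<open>
  The dilatation inequality is given almost everywhere, which says nothing about a single circle.
  Continuity extends it to every point: the set where it fails is open and null, hence empty.
\<close>

lemma AE_le_imp_le_on_open:
  fixes u v :: "'a::euclidean_space \<Rightarrow> real"
  assumes ae: "AE z in lebesgue. z \<in> U \<longrightarrow> u z \<le> v z"
    and "open U" and "continuous_on U u" "continuous_on U v" and "z \<in> U"
  shows "u z \<le> v z"
proof (rule ccontr)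
  assume "\<not> u z \<le> v z"
  let ?S = "U \<inter> (\<lambda>w. u w - v w) -` {0<..}"
  have "open ?S"
    using assms by (intro continuous_open_preimage continuous_on_diff) auto
  moreover have "negligible ?S"
    unfolding negligible_iff_null_sets
  proof (rule AE_iff_null_sets[THEN iffD2])
    show "?S \<in> sets lebesgue" using \<open>open ?S\<close> by (simp add: lmeasurable_open borel_open)
    show "AE w in lebesgue. w \<notin> ?S" using ae by eventually_elim auto
  qed
  moreover have "z \<in> ?S" using \<open>z \<in> U\<close> \<open>\<not> u z \<le> v z\<close> by auto
  ultimately show False using open_not_negligible by blast
qed

lemma circle_vector_derivative_plus_cnj:
  assumes h: "h holomorphic_on U" and g: "g holomorphic_on U" and "open U"
    and f: "\<And>w. w \<in> U \<Longrightarrow> f w = h w + cnj (g w)" and z: "r * cis \<theta> \<in> U"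
  shows "((\<lambda>\<theta>. f (r * cis \<theta>)) has_vector_derivative
    (deriv h (r * cis \<theta>) * (\<i> * r * cis \<theta>) + cnj (deriv g (r * cis \<theta>) * (\<i> * r * cis \<theta>)))) (at \<theta>)"
proof -
  let ?z = "r * cis \<theta>"
  have "(f has_derivative (\<lambda>v. deriv h ?z * v + cnj (deriv g ?z * v))) (at ?z)"
    by (rule has_derivative_transform_within_open[OF
          has_derivative_plus_cnj[OF holomorphic_derivI[OF h \<open>open U\<close> z]
            holomorphic_derivI[OF g \<open>open U\<close> z]] \<open>open U\<close> z]) (simp add: f)
  moreover have "((\<lambda>\<theta>. r * cis \<theta>) has_vector_derivative \<i> * r * cis \<theta>) (at \<theta>)"
    unfolding cis_conv_exp
    by (auto intro!: derivative_eq_intros has_vector_derivative_real_field)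
  ultimately show ?thesis
    using vector_derivative_diff_chain_within[of "\<lambda>\<theta>. r * cis \<theta>" _ \<theta> UNIV f]
      has_derivative_at_withinI by (fastforce simp: o_def)
qed

section \<open>Boundedness of the circular means\<close>

theorem theorem4:
  fixes f :: "complex \<Rightarrow> complex" and G :: "complex set" and K M \<delta> :: real
  assumes "K \<ge> 1"
    and "f \<in> S_H"
    and "quasiconformal K (ball 0 1) G f"
    and "bounded G"
    and "pommerenke_interior_domain f G"
    and "M > 0" and "0 < \<delta>" and "\<delta> < 1"
    and "\<And>\<zeta> r \<rho>. \<lbrakk>\<zeta> \<in> sphere 0 1; 0 \<le> r; r \<le> \<rho>; \<rho> < 1\<rbrakk> \<Longrightarrow>
           D_norm f (of_real \<rho> * \<zeta>) \<le>
             M * D_norm f (of_real r * \<zeta>) * ((1 - \<rho>) / (1 - r)) powr (\<delta> - 1)"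
  shows "(\<lambda>z. complex_of_real (D_norm f z)) \<in> H1_g"
proof -
  let ?B = "ball (0::complex) 1"
  obtain h g where h: "h holomorphic_on ?B" and g: "g holomorphic_on ?B"
    and f: "\<And>z. z \<in> ?B \<Longrightarrow> f z = h z + cnj (g z)" and inj: "inj_on f ?B"
    using \<open>f \<in> S_H\<close> unfolding S_H_def by blast
  have "continuous_on ?B (\<lambda>z. h z + cnj (g z))"
    using h g by (intro continuous_intros holomorphic_on_imp_continuous_on)
  then have contf: "continuous_on ?B f"
    by (subst continuous_on_cong[OF refl f])
  define H' G' where "H' z = norm (deriv h z)" and "G' z = norm (deriv g z)" for z
  have dh: "continuous_on ?B (deriv h)" and dg: "continuous_on ?B (deriv g)"
    using h g by (auto intro!: holomorphic_on_imp_continuous_on holomorphic_deriv)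
  have cont_abs: "continuous_on ?B H'" "continuous_on ?B G'"
    unfolding H'_def G'_def using dh dg by (auto intro: continuous_on_norm)
  have Dz: "D_z f z = deriv h z" and Dzbar: "D_zbar f z = cnj (deriv g z)" if "z \<in> ?B" for z
    using Wirtinger_derivatives_plus_cnj[OF holomorphic_derivI[OF h open_ball that]
        holomorphic_derivI[OF g open_ball that] open_ball that f] by auto
  have N: "D_norm f z = H' z + G' z" and det: "D_det f z = (H' z)\<^sup>2 - (G' z)\<^sup>2" if "z \<in> ?B" for z
    using Dz[OF that] Dzbar[OF that] by (auto simp: D_norm_def D_det_def H'_def G'_def)
  have "continuous_on ?B (\<lambda>z. H' z + G' z)" by (intro continuous_intros cont_abs)
  then have contN: "continuous_on ?B (D_norm f)"
    using N by (subst continuous_on_cong[OF refl N]) auto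
  have dilatation: "D_norm f z \<le> K * (H' z - G' z)" if z: "z \<in> ?B" for z
  proof -
    have "(H' z + G' z)\<^sup>2 \<le> K * ((H' z)\<^sup>2 - (G' z)\<^sup>2)"
    proof (rule AE_le_imp_le_on_open[OF _ open_ball _ _ z])
      show "AE z in lebesgue. z \<in> ?B \<longrightarrow> (H' z + G' z)\<^sup>2 \<le> K * ((H' z)\<^sup>2 - (G' z)\<^sup>2)"
        using \<open>quasiconformal K ?B G f\<close> unfolding quasiconformal_def
        by (auto elim!: eventually_mono simp: N det)
    qed (intro continuous_intros cont_abs)+
    \<comment> \<open>both sides have the factor \<open>H' z + G' z\<close>; if it vanishes, so do \<open>H' z\<close> and \<open>G' z\<close>\<close>
    then have "(H' z + G' z) * (H' z + G' z) \<le> (H' z + G' z) * (K * (H' z - G' z))"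
      by (simp add: power2_eq_square algebra_simps)
    moreover have "H' z \<ge> 0" "G' z \<ge> 0" by (auto simp: H'_def G'_def)
    ultimately show ?thesis
      unfolding N[OF z]
      by (cases "H' z + G' z = 0") (auto simp: mult_le_cancel_left add_nonneg_eq_0_iff)
  qed
  obtain L where "L \<ge> 0" and L: "\<And>r z1 z2. \<lbrakk>0 < r; r < 1; norm z1 = r; norm z2 = r; z1 \<noteq> z2\<rbrakk>
      \<Longrightarrow> smaller_subarc_length f r (f z1) (f z2) \<le> ennreal L"
    using pommerenke_smaller_subarc_bounded[OF \<open>pommerenke_interior_domain f G\<close> \<open>bounded G\<close> inj contf]
    by blast
  have on_circle: "of_real r * cis \<theta> \<in> ?B" if "0 < r" "r < 1" for r \<theta>
    using that by (auto simp: norm_mult)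
  have contN_circle: "continuous_on S (\<lambda>\<theta>. D_norm f (r * cis \<theta>))" if "0 < r" "r < 1" for r :: real and S
    using on_circle[OF that] by (intro continuous_on_compose2[OF contN] continuous_intros) auto
  have absint: "set_integrable lebesgue {0..2 * pi} (\<lambda>\<theta>. D_norm f (r * cis \<theta>))"
    if "0 < r" "r < 1" for r :: real
    using contN_circle[OF that] by (rule absolutely_integrable_continuous_real)
  have nonneg: "D_norm f z \<ge> 0" for z by (simp add: D_norm_def)
  have M1: "M1 r (\<lambda>z. complex_of_real (D_norm f z))
      = 1 / (2 * pi) * integral {0..2 * pi} (\<lambda>\<theta>. D_norm f (r * cis \<theta>))"
    if "0 < r" "r < 1" for r :: real
    using set_lebesgue_integral_eq_integral(2)[OF absint[OF that]] nonneg
    by (simp add: M1_def)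
  have length_bound: "r * integral {0..2 * pi} (\<lambda>\<theta>. D_norm f (r * cis \<theta>)) \<le> K * (2 * L)"
    if r: "0 < r" "r < 1" for r :: real
  proof -
    define c' where "c' \<theta> = deriv h (r * cis \<theta>) * (\<i> * r * cis \<theta>)
        + cnj (deriv g (r * cis \<theta>) * (\<i> * r * cis \<theta>))" for \<theta>
    have deriv: "((\<lambda>\<theta>. f (r * cis \<theta>)) has_vector_derivative c' \<theta>) (at \<theta>)" for \<theta>
      unfolding c'_def
      by (rule circle_vector_derivative_plus_cnj[OF h g open_ball f on_circle[OF r]])
    have contc': "continuous_on S c'" for S
      unfolding c'_def using on_circle[OF r]
      by (intro continuous_intros continuous_on_compose2[OF dh] continuous_on_compose2[OF dg]) auto
    have "inj_on f (sphere 0 r)" using r by (intro inj_on_subset[OF inj]) auto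
    from circle_image_length_le[OF deriv contc' this r(1) \<open>L \<ge> 0\<close> L[OF r]]
    have "integral {0..2 * pi} (\<lambda>\<theta>. norm (c' \<theta>)) \<le> 2 * L" .
    have ptw: "r * D_norm f (r * cis \<theta>) \<le> K * norm (c' \<theta>)" for \<theta>
    proof -
      let ?z = "r * cis \<theta>"
      have "r * (H' ?z - G' ?z) \<le> norm (c' \<theta>)"
        using norm_diff_ineq[of "deriv h ?z * (\<i> * r * cis \<theta>)"
            "cnj (deriv g ?z * (\<i> * r * cis \<theta>))"] r
        by (simp add: c'_def H'_def G'_def norm_mult algebra_simps)
      then have "K * (r * (H' ?z - G' ?z)) \<le> K * norm (c' \<theta>)"
        using \<open>K \<ge> 1\<close> by (intro mult_left_mono) auto
      moreover have "r * D_norm f ?z \<le> r * (K * (H' ?z - G' ?z))"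
        using dilatation[OF on_circle[OF r]] r by (intro mult_left_mono) auto
      ultimately show ?thesis by (simp add: algebra_simps)
    qed
    have "integral {0..2 * pi} (\<lambda>\<theta>. r * D_norm f (r * cis \<theta>))
        \<le> integral {0..2 * pi} (\<lambda>\<theta>. K * norm (c' \<theta>))"
      by (intro integral_le integrable_continuous_real continuous_intros contN_circle r contc' ptw)
    also have "\<dots> \<le> K * (2 * L)"
      using \<open>integral {0..2 * pi} (\<lambda>\<theta>. norm (c' \<theta>)) \<le> 2 * L\<close> \<open>K \<ge> 1\<close> by simp
    finally show ?thesis by simp
  qed
  have "compact ((D_norm f) ` cball 0 (1/2))"
    by (intro compact_continuous_image continuous_on_subset[OF contN]) auto
  then obtain A where A: "\<And>z. z \<in> cball 0 (1/2) \<Longrightarrow> D_norm f z \<le> A"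
    by (meson bdd_above.E bounded_imp_bdd_above compact_imp_bounded imageI)
  have "M1 r (\<lambda>z. complex_of_real (D_norm f z)) \<le> max A (1 / (2 * pi) * (2 * (K * (2 * L))))"
    if r: "0 < r" "r < 1" for r :: real
  proof (cases "r \<le> 1 / 2")
    case True
    have "integral {0..2 * pi} (\<lambda>\<theta>. D_norm f (r * cis \<theta>)) \<le> integral {0..2 * pi} (\<lambda>\<theta>. A)"
      using True r
      by (intro integral_le integrable_continuous_real contN_circle r continuous_intros A)
        (auto simp: norm_mult)
    then show ?thesis unfolding M1[OF r] by (simp add: field_simps max.coboundedI1)
  next
    case False
    let ?I = "integral {0..2 * pi} (\<lambda>\<theta>. D_norm f (r * cis \<theta>))"
    have "?I \<ge> 0"
      by (intro integral_nonneg integrable_continuous_real contN_circle r nonneg)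
    then have "1 / 2 * ?I \<le> r * ?I" using False by (intro mult_right_mono) auto
    then have "?I \<le> 2 * (K * (2 * L))" using length_bound[OF r] by linarith
    then show ?thesis unfolding M1[OF r]
      by (intro max.coboundedI2 mult_left_mono) auto
  qed
  then have "bdd_above ((\<lambda>r. M1 r (\<lambda>z. complex_of_real (D_norm f z))) ` {0<..<1})"
    by (intro bdd_aboveI2) auto
  moreover have "(\<lambda>z. complex_of_real (D_norm f z)) \<in> borel_measurable (lebesgue_on ?B)"
    by (intro continuous_imp_measurable_on_sets_lebesgue continuous_intros contN) auto
  moreover have "set_integrable lebesgue {0..2 * pi}
      (\<lambda>\<theta>. norm (complex_of_real (D_norm f (r * cis \<theta>))))" if "r \<in> {0<..<1}" for r :: complex
  proof -
    \<comment> \<open>the radius is a complex number here; in the order of \<open>complex\<close> the elements strictly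
      between \<open>0\<close> and \<open>1\<close> are the real ones\<close>
    have "Im r = 0" and "0 < Re r" "Re r < 1"
      using that by (auto simp: less_complex_def)
    moreover from this have "r = of_real (Re r)" by (simp add: complex_eq_iff)
    ultimately show ?thesis using absint[of "Re r"] nonneg by simp
  qed
  ultimately show ?thesis by (simp add: H1_g_def)
qed

end
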